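(* Let $p$ be a prime and $G$ a finite $p$-group of exponent $p$ in which every non-abelian subgroup $H$ satisfies $C_G(H)\le H$. If $|G|>p^p$, then $G$ is elementary abelian. Otherwise, either $G$ is elementary abelian, or $G$ has maximal class and has an elementary abelian subgroup of index $p$.
   Context: A group of order $p^n$ ($n\ge 2$) has maximal class if its nilpotency class is $n-1$. $C_G(H)$ denotes the centralizer of $H$ in $G$. *)

theory Defs
  imports "HOL-Algebra.Algebra"
begin

definition centralizer :: "('a, 'b) monoid_scheme \<Rightarrow> 'a set \<Rightarrow> 'a set" where
  "centralizer G H = {g \<in> carrier G. \<forall>h \<in> H. g \<otimes>\<^bsub>G\<^esub> h = h \<otimes>\<^bsub>G\<^esub> g}"

definition commutator_subgroup :: "('a, 'b) monoid_scheme \<Rightarrow> 'a set \<Rightarrow> 'a set \<Rightarrow> 'a set" where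
  "commutator_subgroup G H K = generate G
     (\<Union>h \<in> H. \<Union>k \<in> K. {h \<otimes>\<^bsub>G\<^esub> k \<otimes>\<^bsub>G\<^esub> inv\<^bsub>G\<^esub> h \<otimes>\<^bsub>G\<^esub> inv\<^bsub>G\<^esub> k})"

text \<open>Lower central series: lcs G 0 = G = gamma_1, lcs G (Suc i) = [lcs G i, G], so lcs G i = gamma_(i+1).\<close>
fun lower_central :: "('a, 'b) monoid_scheme \<Rightarrow> nat \<Rightarrow> 'a set" where
  "lower_central G 0 = carrier G"
| "lower_central G (Suc i) = commutator_subgroup G (lower_central G i) (carrier G)"

definition nilpotent_group :: "('a, 'b) monoid_scheme \<Rightarrow> bool" where
  "nilpotent_group G \<longleftrightarrow> group G \<and> (\<exists>c. lower_central G c = {\<one>\<^bsub>G\<^esub>})"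

definition nilpotency_class :: "('a, 'b) monoid_scheme \<Rightarrow> nat" where
  "nilpotency_class G = (LEAST c. lower_central G c = {\<one>\<^bsub>G\<^esub>})"

definition maximal_class :: "nat \<Rightarrow> ('a, 'b) monoid_scheme \<Rightarrow> bool" where
  "maximal_class p G \<longleftrightarrow> (\<exists>n. n \<ge> 2 \<and> order G = p ^ n \<and> nilpotent_group G
                              \<and> nilpotency_class G = n - 1)"

definition elementary_abelian :: "nat \<Rightarrow> ('a, 'b) monoid_scheme \<Rightarrow> bool" where
  "elementary_abelian p G \<longleftrightarrow> comm_group G \<and> (\<forall>x \<in> carrier G. x [^]\<^bsub>G\<^esub> p = \<one>\<^bsub>G\<^esub>)"

definition has_exponent :: "('a, 'b) monoid_scheme \<Rightarrow> nat \<Rightarrow> bool" where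
  "has_exponent G e \<longleftrightarrow> e > 0 \<and> (\<forall>x \<in> carrier G. x [^]\<^bsub>G\<^esub> e = \<one>\<^bsub>G\<^esub>)
     \<and> (\<forall>d. 0 < d \<longrightarrow> (\<forall>x \<in> carrier G. x [^]\<^bsub>G\<^esub> d = \<one>\<^bsub>G\<^esub>) \<longrightarrow> e dvd d)"

end

theory Submission
  imports Defs
begin

text \<open>
  Suppose \<open>G\<close> is not abelian and pick a non-central \<open>y\<close> that is central modulo \<open>Z(G)\<close>.
  If \<open>x\<close> does not commute with \<open>y\<close>, then \<open>\<langle>x, y\<rangle>\<close> is non-abelian with centre
  generated by \<open>[x, y]\<close>, and it contains its centralizer, hence \<open>Z(G)\<close>; so \<open>|Z(G)| = p\<close>.
  The same holds for every non-abelian subgroup. Now \<open>A = C\<^sub>G(y)\<close> has index \<open>p\<close>, being the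
  kernel of the homomorphism \<open>g \<mapsto> [g, y]\<close> onto \<open>Z(G)\<close>, and its centre contains both
  \<open>Z(G)\<close> and \<open>y\<close>, so \<open>A\<close> is abelian.

  For \<open>x \<notin> A\<close> the endomorphism \<open>T a = [x, a]\<close> of \<open>A\<close> has kernel \<open>Z(G)\<close>. Written
  additively, conjugation by \<open>x\<close> is \<open>1 + T\<close>, so
  \<open>(a x)\<^sup>p = (\<Sum>\<^sub>k\<^sub><\<^sub>p (1 + T)\<^sup>k a) x\<^sup>p\<close>, and the sum equals
  \<open>\<Sum>\<^sub>j\<^sub><\<^sub>p (p choose (j + 1)) T\<^sup>j a = T\<^sup>p\<^sup>-\<^sup>1 a\<close>; hence exponent \<open>p\<close> gives
  \<open>T\<^sup>p\<^sup>-\<^sup>1 = 0\<close>. It follows that each image \<open>T\<^sup>i(A)\<close> has index \<open>p\<close> in the preceding one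
  until the trivial group is reached, which bounds \<open>|A|\<close> by \<open>p\<^sup>p\<^sup>-\<^sup>1\<close>. Since the \<open>T\<^sup>i(A)\<close>
  with \<open>i \<ge> 1\<close> are the terms of the lower central series, \<open>G\<close> has maximal class.
\<close>

section \<open>Centralizers and commutators\<close>

abbreviation center :: "('a, 'b) monoid_scheme \<Rightarrow> 'a set" where
  "center G \<equiv> centralizer G (carrier G)"

lemma centralizerI:
  "a \<in> carrier G \<Longrightarrow> (\<And>h. h \<in> K \<Longrightarrow> a \<otimes>\<^bsub>G\<^esub> h = h \<otimes>\<^bsub>G\<^esub> a) \<Longrightarrow> a \<in> centralizer G K"
  by (simp add: centralizer_def)

lemma centralizerD:
  "a \<in> centralizer G K \<Longrightarrow> h \<in> K \<Longrightarrow> a \<otimes>\<^bsub>G\<^esub> h = h \<otimes>\<^bsub>G\<^esub> a"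
  by (simp add: centralizer_def)

lemma centralizer_subset: "centralizer G K \<subseteq> carrier G"
  by (auto simp: centralizer_def)

lemma centralizer_antimono: "K \<subseteq> L \<Longrightarrow> centralizer G L \<subseteq> centralizer G K"
  by (auto simp: centralizer_def)

lemma centralizer_carrier_update:
  "A \<subseteq> carrier G \<Longrightarrow> centralizer (G\<lparr>carrier := A\<rparr>) K = A \<inter> centralizer G K"
  by (auto simp: centralizer_def)

context group
begin

lemma mult_inv_cancel_left:
  assumes "a \<in> carrier G" "b \<in> carrier G"
  shows "a \<otimes> (inv a \<otimes> b) = b" "inv a \<otimes> (a \<otimes> b) = b"
  using assms by (simp_all flip: m_assoc)

lemmas group_word_simps = m_assoc inv_mult_group mult_inv_cancel_left

lemma conj_eq_self_iff:
  assumes "g \<in> carrier G" "h \<in> carrier G"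
  shows "g \<otimes> h \<otimes> inv g = h \<longleftrightarrow> g \<otimes> h = h \<otimes> g"
  using assms inv_solve_right'[of h "g \<otimes> h" g] by simp

lemma conj_mult:
  assumes "g \<in> carrier G" "h \<in> carrier G" "a \<in> carrier G"
  shows "g \<otimes> h \<otimes> a \<otimes> inv (g \<otimes> h) = g \<otimes> (h \<otimes> a \<otimes> inv h) \<otimes> inv g"
  using assms by (simp add: group_word_simps)

definition commutator :: "'a \<Rightarrow> 'a \<Rightarrow> 'a" where
  "commutator g h = g \<otimes> h \<otimes> inv g \<otimes> inv h"

lemma commutator_closed [simp]:
  "g \<in> carrier G \<Longrightarrow> h \<in> carrier G \<Longrightarrow> commutator g h \<in> carrier G"
  by (simp add: commutator_def)

lemma inv_commutator:
  "g \<in> carrier G \<Longrightarrow> h \<in> carrier G \<Longrightarrow> inv (commutator g h) = commutator h g"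
  by (simp add: commutator_def group_word_simps)

lemma mult_eq_commutator_mult:
  "g \<in> carrier G \<Longrightarrow> h \<in> carrier G \<Longrightarrow> g \<otimes> h = commutator g h \<otimes> (h \<otimes> g)"
  by (simp add: commutator_def group_word_simps)

lemma commutator_eq_one_iff:
  assumes "g \<in> carrier G" "h \<in> carrier G"
  shows "commutator g h = \<one> \<longleftrightarrow> g \<otimes> h = h \<otimes> g"
proof -
  have "commutator g h = (g \<otimes> h) \<otimes> inv (h \<otimes> g)"
    using assms by (simp add: commutator_def group_word_simps)
  then show ?thesis
    using assms inv_solve_right'[of \<one> "g \<otimes> h" "h \<otimes> g"] by simp
qed

lemma commutator_mult_left:
  assumes "g \<in> carrier G" "h \<in> carrier G" "k \<in> carrier G"
  shows "commutator (g \<otimes> h) k = (g \<otimes> commutator h k \<otimes> inv g) \<otimes> commutator g k"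
  using assms by (simp add: commutator_def group_word_simps)

lemma commutator_mult_right:
  assumes "g \<in> carrier G" "h \<in> carrier G" "k \<in> carrier G"
  shows "commutator g (h \<otimes> k) = commutator g h \<otimes> (h \<otimes> commutator g k \<otimes> inv h)"
  using assms by (simp add: commutator_def group_word_simps)

lemma commutator_inv_right:
  assumes "g \<in> carrier G" "h \<in> carrier G"
  shows "commutator g (inv h) = inv h \<otimes> commutator h g \<otimes> h"
  using assms by (simp add: commutator_def group_word_simps)

lemma conj_commutator:
  assumes "g \<in> carrier G" "h \<in> carrier G" "k \<in> carrier G"
  shows "g \<otimes> commutator h k \<otimes> inv g = commutator (g \<otimes> h \<otimes> inv g) (g \<otimes> k \<otimes> inv g)"
  using assms by (simp add: commutator_def group_word_simps)

lemma commutator_pow_right: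
  assumes "g \<in> carrier G" "h \<in> carrier G" and comm: "commutator g h \<otimes> h = h \<otimes> commutator g h"
  shows "commutator g (h [^] (n::nat)) = commutator g h [^] n"
proof (induction n)
  case 0
  show ?case using assms by (simp add: commutator_eq_one_iff)
next
  case (Suc n)
  have "h [^] n \<otimes> commutator g h = commutator g h \<otimes> h [^] n"
    using group_commutes_pow[of h "commutator g h" n] assms by simp
  then have "h [^] n \<otimes> commutator g h \<otimes> inv (h [^] n) = commutator g h"
    by (rule conj_eq_self_iff[THEN iffD2, rotated 2]) (use assms in simp_all)
  then show ?case
    using assms(1,2) Suc by (simp add: commutator_mult_right)
qed

lemma commutator_subgroup_eq_generate:
  "commutator_subgroup G H K = generate G {commutator h k | h k. h \<in> H \<and> k \<in> K}"
  unfolding commutator_subgroup_def commutator_def by (rule arg_cong[where f = "generate G"]) blast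

lemma subgroup_commutator_mem:
  assumes "N \<lhd> G" "g \<in> carrier G"
  shows "subgroup {h \<in> carrier G. commutator g h \<in> N} G"
proof -
  interpret N: normal N G by fact
  show ?thesis
  proof (rule subgroupI)
    have "\<one> \<in> {h \<in> carrier G. commutator g h \<in> N}"
      using assms(2) by (simp add: commutator_def)
    then show "{h \<in> carrier G. commutator g h \<in> N} \<noteq> {}"
      by blast
  next
    fix h assume h: "h \<in> {h \<in> carrier G. commutator g h \<in> N}"
    then have "commutator h g \<in> N"
      using assms(2) N.m_inv_closed[of "commutator g h"] by (simp add: inv_commutator)
    then show "inv h \<in> {h \<in> carrier G. commutator g h \<in> N}"
      using assms(2) h N.inv_op_closed1 by (simp add: commutator_inv_right)
  next
    fix h k
    assume "h \<in> {h \<in> carrier G. commutator g h \<in> N}" "k \<in> {h \<in> carrier G. commutator g h \<in> N}"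
    then show "h \<otimes> k \<in> {h \<in> carrier G. commutator g h \<in> N}"
      using assms(2) N.inv_op_closed2 by (simp add: commutator_mult_right)
  qed auto
qed

lemma subgroup_conj_equivariant:
  assumes "A \<lhd> G" and T: "\<And>a. a \<in> A \<Longrightarrow> T a \<in> carrier G"
  shows "subgroup {g \<in> carrier G. \<forall>a \<in> A. g \<otimes> T a \<otimes> inv g = T (g \<otimes> a \<otimes> inv g)} G"
    (is "subgroup ?S G")
proof -
  interpret A: normal A G by fact
  show ?thesis
  proof (rule subgroupI)
    have "\<one> \<in> ?S"
      using T by simp
    then show "?S \<noteq> {}"
      by blast
  next
    fix g assume g: "g \<in> ?S"
    have "inv g \<otimes> T a \<otimes> g = T (inv g \<otimes> a \<otimes> g)" if a: "a \<in> A" for a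
    proof -
      let ?b = "inv g \<otimes> a \<otimes> g"
      have b: "?b \<in> A"
        using g a A.inv_op_closed1 by simp
      have "g \<otimes> ?b \<otimes> inv g = a"
        using g a by (simp add: group_word_simps)
      then have "T a = g \<otimes> T ?b \<otimes> inv g"
        using g b by auto
      then show ?thesis
        using g T[OF b] by (simp add: group_word_simps)
    qed
    then show "inv g \<in> ?S"
      using g by simp
  next
    fix g h assume gh: "g \<in> ?S" "h \<in> ?S"
    then show "g \<otimes> h \<in> ?S"
      using T A.inv_op_closed2 by (simp add: conj_mult)
  qed auto
qed

lemma subgroup_centralizer:
  assumes "K \<subseteq> carrier G"
  shows "subgroup (centralizer G K) G"
proof (rule subgroupI)
  have "\<one> \<in> centralizer G K"
    using assms by (auto simp: centralizer_def)
  then show "centralizer G K \<noteq> {}"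
    by blast
next
  fix a assume a: "a \<in> centralizer G K"
  then have aG: "a \<in> carrier G"
    using centralizer_subset[of G K] by blast
  show "inv a \<in> centralizer G K"
  proof (rule centralizerI)
    fix h assume "h \<in> K"
    then have "a \<otimes> h = h \<otimes> a" "h \<in> carrier G"
      using assms by (auto intro: centralizerD[OF a])
    then show "inv a \<otimes> h = h \<otimes> inv a"
      using aG by (metis conj_eq_self_iff inv_closed inv_solve_left m_assoc m_closed)
  qed (use aG in simp)
next
  fix a b assume a: "a \<in> centralizer G K" and b: "b \<in> centralizer G K"
  then have abG: "a \<in> carrier G" "b \<in> carrier G"
    using centralizer_subset[of G K] by blast+
  show "a \<otimes> b \<in> centralizer G K"
  proof (rule centralizerI)
    fix h assume "h \<in> K"
    then have "a \<otimes> h = h \<otimes> a" "b \<otimes> h = h \<otimes> b" "h \<in> carrier G"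
      using assms by (auto intro: centralizerD[OF a] centralizerD[OF b])
    then show "a \<otimes> b \<otimes> h = h \<otimes> (a \<otimes> b)"
      using abG by (metis m_assoc)
  qed (use abG in simp)
qed (rule centralizer_subset)

lemma mem_center_iff:
  assumes "y \<in> carrier G"
  shows "y \<in> center G \<longleftrightarrow> (\<forall>x \<in> carrier G. commutator x y = \<one>)"
  using assms by (auto simp: centralizer_def commutator_eq_one_iff)

lemma center_normal: "center G \<lhd> G"
proof (rule normal_invI)
  fix g z assume "g \<in> carrier G" and z: "z \<in> center G"
  then have "g \<otimes> z \<otimes> inv g = z"
    using centralizerD[OF z] subsetD[OF centralizer_subset z] by (simp add: conj_eq_self_iff)
  then show "g \<otimes> z \<otimes> inv g \<in> center G"
    using z by simp
qed (simp add: subgroup_centralizer)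

lemma center_eq_carrier_iff: "center G = carrier G \<longleftrightarrow> comm_group G"
proof
  assume "center G = carrier G"
  then show "comm_group G"
    by (intro group_comm_groupI) (metis centralizerD)
next
  assume "comm_group G"
  then interpret comm_group G .
  show "center G = carrier G"
    by (auto simp: centralizer_def m_comm)
qed

definition second_center :: "'a set" where
  "second_center = {y \<in> carrier G. \<forall>g \<in> carrier G. commutator g y \<in> center G}"

lemma second_center_closed: "y \<in> second_center \<Longrightarrow> y \<in> carrier G"
  by (simp add: second_center_def)

lemma commutator_mem_center:
  "y \<in> second_center \<Longrightarrow> g \<in> carrier G \<Longrightarrow> commutator g y \<in> center G"
  by (simp add: second_center_def)

lemma commutator_hom_if_second_center:
  assumes "y \<in> second_center"
  shows "(\<lambda>g. commutator g y) \<in> hom G G"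
proof (rule homI)
  note y = second_center_closed[OF assms]
  fix g h assume gh: "g \<in> carrier G" "h \<in> carrier G"
  note central = centralizerD[OF commutator_mem_center[OF assms gh(2)]]
  have "g \<otimes> commutator h y \<otimes> inv g = commutator h y"
    using gh y central[OF gh(1)] conj_eq_self_iff by simp
  then show "commutator (g \<otimes> h) y = commutator g y \<otimes> commutator h y"
    using gh y central[of "commutator g y"] by (simp add: commutator_mult_left)
qed (use second_center_closed[OF assms] in simp)

lemma kernel_commutator:
  assumes "y \<in> carrier G"
  shows "kernel G G (\<lambda>g. commutator g y) = centralizer G {y}"
  using assms by (auto simp: kernel_def centralizer_def commutator_eq_one_iff)

lemma card_subgroup_dvd_card_subgroup:
  assumes "subgroup H G" "subgroup K G" "H \<subseteq> K"
  shows "card H dvd card K"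
proof -
  interpret K: group "G\<lparr>carrier := K\<rparr>"
    using assms(2) by (rule subgroup_imp_group)
  have "card (rcosets\<^bsub>G\<lparr>carrier := K\<rparr>\<^esub> H) * card H = card K"
    using K.lagrange[OF subgroup_incl[OF assms]] by (simp add: order_def)
  then show ?thesis
    by (metis dvd_triv_right)
qed

lemma subgroup_prime_card_cases:
  assumes "subgroup H G" "subgroup K G" "H \<subseteq> K" "Factorial_Ring.prime (card K)"
  shows "H = {\<one>} \<or> H = K"
proof -
  have "card H = 1 \<or> card H = card K"
    using card_subgroup_dvd_card_subgroup[OF assms(1-3)] assms(4) by (auto simp: prime_nat_iff)
  moreover have "H = {\<one>}" if "card H = 1"
    using that subgroup.one_closed[OF assms(1)] by (auto simp: card_1_singleton_iff)
  moreover have "H = K" if "card H = card K"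
    using that assms(3,4) card_subset_eq[of K H] prime_gt_0_nat card_ge_0_finite by blast
  ultimately show ?thesis by blast
qed

lemma prime_index_maximal:
  assumes "finite (carrier G)" "subgroup A G" "Factorial_Ring.prime (card (rcosets A))"
    and "subgroup S G" "A \<subset> S"
  shows "S = carrier G"
proof -
  have finS: "finite S"
    using finite_subset[OF subgroup.subset[OF assms(4)] assms(1)] .
  have "card A > 0"
    using subgroup.finite_imp_card_positive[OF assms(2,1)] .
  obtain l where l: "card S = card A * l"
    using card_subgroup_dvd_card_subgroup[OF assms(2,4)] assms(5) by (auto elim: dvdE)
  have "card (rcosets S) * l * card A = card (rcosets A) * card A"
    using lagrange[OF assms(2)] lagrange[OF assms(4)] by (simp add: l ac_simps)
  then have "card (rcosets S) * l = card (rcosets A)"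
    using \<open>card A > 0\<close> by simp
  moreover have "l \<noteq> 1"
    using psubset_card_mono[OF finS assms(5)] l by auto
  ultimately have "card (rcosets S) = 1"
    using assms(3) by (metis prime_product mult_cancel_left1)
  then show ?thesis
    using lagrange[OF assms(4)] card_subset_eq[OF assms(1) subgroup.subset[OF assms(4)]]
    by (simp add: order_def)
qed

lemma ord_eq_prime:
  assumes "Factorial_Ring.prime p" "a \<in> carrier G" "a [^] p = \<one>" "a \<noteq> \<one>"
  shows "ord a = p"
proof -
  have "ord a dvd p" using assms pow_eq_id by blast
  moreover have "ord a \<noteq> 1" using assms ord_eq_1 by blast
  ultimately show ?thesis using assms(1) by (metis One_nat_def prime_nat_iff)
qed

lemma generate_subset_if_left_mult_closed:
  assumes "K \<subseteq> carrier G" "finite S" "S \<subseteq> carrier G" "\<one> \<in> S"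
    and closed: "\<And>k s. k \<in> K \<Longrightarrow> s \<in> S \<Longrightarrow> k \<otimes> s \<in> S"
  shows "generate G K \<subseteq> S"
proof
  fix g assume g: "g \<in> generate G K"
  then have "\<forall>s \<in> S. g \<otimes> s \<in> S"
  proof (induction rule: generate.induct)
    case (inv k)
    then have k: "k \<in> carrier G"
      using assms(1) by blast
    have "inj_on ((\<otimes>) k) S"
      using k assms(3) inj_on_subset[OF inj_on_cmult] by blast
    then have "(\<otimes>) k ` S = S"
      using inv closed by (intro endo_inj_surj assms(2)) auto
    then show ?case
      using k assms(3) mult_inv_cancel_left(2)[OF k] by (metis imageE subsetD)
  next
    case (eng g h)
    then show ?case
      using assms(1,3) generate_in_carrier by (metis m_assoc subsetD)
  qed (use assms in auto)
  then show "g \<in> S"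
    using assms(1,4) generate_in_carrier[OF _ g] by force
qed

end

lemma (in group_hom) card_rcosets_kernel: "card (rcosets (kernel G H h)) = card (h ` carrier G)"
proof -
  interpret h: group_hom G "H\<lparr>carrier := h ` carrier G\<rparr>" h
    using induced_group_hom[OF G.subgroup_self] by simp
  have "bij_betw (\<lambda>C. the_elem (h ` C)) (rcosets (kernel G H h)) (h ` carrier G)"
    using h.FactGroup_iso_set by (simp add: iso_def kernel_def FactGroup_def)
  then show ?thesis
    by (rule bij_betw_same_card)
qed

section \<open>Finite p-groups\<close>

locale p_group = group G for G (structure) +
  fixes p :: nat
  assumes prime_p: "Factorial_Ring.prime p"
    and order_prime_power: "\<exists>n. order G = p ^ n"
begin

lemma finite_carrier: "finite (carrier G)"
  using order_prime_power prime_gt_0_nat[OF prime_p] order_gt_0_iff_finite by auto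

lemma dvd_order_prime_power: "d dvd order G \<Longrightarrow> \<exists>k. d = p ^ k"
  using order_prime_power divides_primepow_nat[OF prime_p] by auto

lemma prime_dvd_if_dvd_order: "d dvd order G \<Longrightarrow> d \<noteq> 1 \<Longrightarrow> p dvd d"
  using dvd_order_prime_power by (metis dvd_power neq0_conv power_0)

lemma p_group_subgroup:
  assumes "subgroup H G"
  shows "p_group (G\<lparr>carrier := H\<rparr>) p"
proof -
  have "\<exists>k. card H = p ^ k"
    using card_subgroup_dvd_card_subgroup[OF assms subgroup_self] subgroup.subset[OF assms]
    by (auto simp: order_def intro: dvd_order_prime_power)
  then show ?thesis
    using prime_p subgroup_imp_group[OF assms]
    by (auto simp: p_group_def p_group_axioms_def order_def)
qed

lemma p_group_FactGroup:
  assumes "N \<lhd> G"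
  shows "p_group (G Mod N) p"
proof -
  have "order (G Mod N) dvd order G"
    using lagrange[OF normal_imp_subgroup[OF assms]]
    by (metis FactGroup_def dvd_triv_left order_def partial_object.select_convs(1))
  then show ?thesis
    using assms prime_p dvd_order_prime_power normal.factorgroup_is_group
    by (auto simp: p_group_def p_group_axioms_def)
qed

lemma prime_dvd_card_orbit:
  assumes "group_action G E \<phi>" "x \<in> E" "orbit G \<phi> x \<noteq> {x}"
  shows "p dvd card (orbit G \<phi> x)"
proof (rule prime_dvd_if_dvd_order)
  interpret group_action G E \<phi> by fact
  show "card (orbit G \<phi> x) dvd order G"
    using orbit_stabilizer_theorem[OF assms(2)] by (metis dvd_triv_left)
  show "card (orbit G \<phi> x) \<noteq> 1"
    using orbit_refl[OF assms(2)] assms(3) by (auto simp: card_1_singleton_iff)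
qed

lemma card_fixed_points_mod:
  assumes "group_action G E \<phi>" "finite E"
  shows "card {x \<in> E. \<forall>g \<in> carrier G. \<phi> g x = x} mod p = card E mod p"
proof -
  interpret group_action G E \<phi> by fact
  let ?F = "{x \<in> E. \<forall>g \<in> carrier G. \<phi> g x = x}" and ?O = "orbits G E \<phi>"
  have fixed_iff: "x \<in> ?F \<longleftrightarrow> orbit G \<phi> x = {x}" if "x \<in> E" for x
    using that orbit_refl[OF that] by (auto simp: orbit_def)
  have finO: "finite ?O"
    using assms(2) by (simp add: orbits_def)
  have singletons: "(\<lambda>x. {x}) ` ?F \<subseteq> ?O"
    using fixed_iff by (fastforce simp: orbits_def)
  have "card E = (\<Sum>orb\<in>?O. card orb)"
    using disjoint_sum[OF assms(2), of "\<lambda>_. 1 :: nat"] by simp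
  also have "\<dots> = (\<Sum>orb\<in>?O - (\<lambda>x. {x}) ` ?F. card orb) + (\<Sum>orb\<in>(\<lambda>x. {x}) ` ?F. card orb)"
    by (rule sum.subset_diff[OF singletons finO])
  also have "(\<Sum>orb\<in>(\<lambda>x. {x}) ` ?F. card orb) = card ?F"
    by (subst sum.reindex) auto
  finally have "card E = (\<Sum>orb\<in>?O - (\<lambda>x. {x}) ` ?F. card orb) + card ?F" .
  moreover have "p dvd (\<Sum>orb\<in>?O - (\<lambda>x. {x}) ` ?F. card orb)"
  proof (rule dvd_sum)
    fix orb assume "orb \<in> ?O - (\<lambda>x. {x}) ` ?F"
    then obtain x where x: "x \<in> E" "orb = orbit G \<phi> x" "orb \<notin> (\<lambda>x. {x}) ` ?F"
      by (auto simp: orbits_def)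
    then show "p dvd card orb"
      using prime_dvd_card_orbit[OF assms(1)] fixed_iff by blast
  qed
  ultimately show ?thesis
    by (auto simp: dvd_def)
qed

lemma center_nontrivial:
  assumes "carrier G \<noteq> {\<one>}"
  shows "center G \<noteq> {\<one>}"
proof
  assume triv: "center G = {\<one>}"
  let ?conj = "\<lambda>g. \<lambda>h \<in> carrier G. g \<otimes> h \<otimes> inv g"
  have "{h \<in> carrier G. \<forall>g \<in> carrier G. ?conj g h = h} = center G"
    by (auto simp: centralizer_def conj_eq_self_iff)
  then have "1 mod p = order G mod p"
    using card_fixed_points_mod[OF action_by_conjugation finite_carrier] by (simp add: triv order_def)
  moreover have "p dvd order G"
    using assms order_one_triv_iff by (auto intro: prime_dvd_if_dvd_order)
  ultimately show False
    using prime_p by (auto dest: prime_gt_1_nat)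
qed

lemma second_center_not_subset_center:
  assumes "\<not> comm_group G"
  shows "\<not> second_center \<subseteq> center G"
proof -
  interpret Z: normal "center G" G by (rule center_normal)
  interpret Q: p_group "G Mod center G" p
    by (rule p_group_FactGroup) (rule center_normal)
  have "carrier (G Mod center G) \<noteq> {\<one>\<^bsub>G Mod center G\<^esub>}"
    using assms Z.fact_group_trivial_iff[OF finite_carrier] center_eq_carrier_iff by simp
  then have "center (G Mod center G) \<noteq> {center G}"
    using Q.center_nontrivial by simp
  moreover have "center G \<in> center (G Mod center G)"
    using subgroup.one_closed[OF Q.subgroup_centralizer] by force
  ultimately obtain Y where Y: "Y \<in> center (G Mod center G)" "Y \<noteq> center G"
    by auto
  then have "Y \<in> (#>) (center G) ` carrier G"
    using subsetD[OF centralizer_subset Y(1)] by (simp only: carrier_FactGroup)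
  then obtain y where y: "y \<in> carrier G" "Y = center G #> y"
    by blast
  have "commutator g y \<in> center G" if g: "g \<in> carrier G" for g
  proof -
    have "center G #> (g \<otimes> y) = center G #> (y \<otimes> g)"
      using centralizerD[OF Y(1), of "center G #> g"] y g by (simp add: carrier_FactGroup Z.rcos_sum)
    then have "(g \<otimes> y) \<otimes> inv (y \<otimes> g) \<in> center G"
      using y g rcos_self[OF _ Z.subgroup_axioms] by (metis Z.rcos_module_imp group_axioms m_closed)
    then show ?thesis
      using y g by (simp add: commutator_def group_word_simps)
  qed
  moreover have "y \<notin> center G"
    using Y(2) y Z.rcos_const[OF group_axioms] by blast
  ultimately show ?thesis
    using y by (auto simp: second_center_def)
qed

end

section \<open>Non-abelian subgroups containing their centralizers\<close>

context group
begin

definition commutator_word :: "'a \<Rightarrow> 'a \<Rightarrow> nat \<Rightarrow> nat \<Rightarrow> nat \<Rightarrow> 'a" where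
  "commutator_word x y i j k = commutator x y [^] k \<otimes> (y [^] j \<otimes> x [^] i)"

lemma commutator_word_closed [simp]:
  "x \<in> carrier G \<Longrightarrow> y \<in> carrier G \<Longrightarrow> commutator_word x y i j k \<in> carrier G"
  by (simp add: commutator_word_def)

lemma mult_commutator_word_fst:
  assumes G: "x \<in> carrier G" "y \<in> carrier G"
    and comm_x: "commutator x y \<otimes> x = x \<otimes> commutator x y"
    and comm_y: "commutator x y \<otimes> y = y \<otimes> commutator x y"
  shows "x \<otimes> commutator_word x y i j k = commutator_word x y (Suc i) j (k + j)"
proof -
  let ?z = "commutator x y"
  have z: "?z \<in> carrier G"
    using G by simp
  have "x \<otimes> commutator_word x y i j k = (x \<otimes> ?z [^] k) \<otimes> (y [^] j \<otimes> x [^] i)"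
    using G z by (simp add: commutator_word_def m_assoc)
  also have "x \<otimes> ?z [^] k = ?z [^] k \<otimes> x"
    using group_commutes_pow[OF comm_x z G(1), of k] by simp
  also have "?z [^] k \<otimes> x \<otimes> (y [^] j \<otimes> x [^] i) = ?z [^] k \<otimes> (x \<otimes> y [^] j) \<otimes> x [^] i"
    using G z by (simp add: m_assoc)
  also have "x \<otimes> y [^] j = ?z [^] j \<otimes> (y [^] j \<otimes> x)"
    using G mult_eq_commutator_mult[of x "y [^] j"] commutator_pow_right[OF G comm_y] by simp
  also have "?z [^] k \<otimes> (?z [^] j \<otimes> (y [^] j \<otimes> x)) \<otimes> x [^] i
      = (?z [^] k \<otimes> ?z [^] j) \<otimes> (y [^] j \<otimes> (x \<otimes> x [^] i))"
    using G z by (simp add: m_assoc)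
  finally show ?thesis
    using nat_pow_mult[OF z] nat_pow_Suc2[OF G(1)] by (simp add: commutator_word_def)
qed

lemma mult_commutator_word_snd:
  assumes G: "x \<in> carrier G" "y \<in> carrier G"
    and comm_y: "commutator x y \<otimes> y = y \<otimes> commutator x y"
  shows "y \<otimes> commutator_word x y i j k = commutator_word x y i (Suc j) k"
proof -
  let ?z = "commutator x y"
  have z: "?z \<in> carrier G"
    using G by simp
  have "y \<otimes> commutator_word x y i j k = (y \<otimes> ?z [^] k) \<otimes> (y [^] j \<otimes> x [^] i)"
    using G z by (simp add: commutator_word_def m_assoc)
  also have "y \<otimes> ?z [^] k = ?z [^] k \<otimes> y"
    using group_commutes_pow[OF comm_y z G(2), of k] by simp
  also have "?z [^] k \<otimes> y \<otimes> (y [^] j \<otimes> x [^] i) = ?z [^] k \<otimes> ((y \<otimes> y [^] j) \<otimes> x [^] i)"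
    using G z by (simp add: m_assoc)
  finally show ?thesis
    using nat_pow_Suc2[OF G(2)] by (simp add: commutator_word_def)
qed

lemma generate_pair_subset_commutator_words:
  assumes "finite (carrier G)" and G: "x \<in> carrier G" "y \<in> carrier G"
    and comm: "commutator x y \<otimes> x = x \<otimes> commutator x y" "commutator x y \<otimes> y = y \<otimes> commutator x y"
  shows "generate G {x, y} \<subseteq> {commutator_word x y i j k | i j k. True}" (is "_ \<subseteq> ?W")
proof (rule generate_subset_if_left_mult_closed)
  show "?W \<subseteq> carrier G"
    using G by auto
  then show "finite ?W"
    using assms(1) by (rule finite_subset)
  have "commutator_word x y 0 0 0 = \<one>"
    by (simp add: commutator_word_def)
  then show "\<one> \<in> ?W"
    by (metis (mono_tags, lifting) mem_Collect_eq)
  fix g w assume "g \<in> {x, y}" "w \<in> ?W"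
  then show "g \<otimes> w \<in> ?W"
    using mult_commutator_word_fst[OF G comm] mult_commutator_word_snd[OF G comm(2)] by blast
qed (use G in auto)

end

locale exponent_p_group = p_group +
  assumes pow_p_eq_one: "a \<in> carrier G \<Longrightarrow> a [^] p = \<one>"
begin

lemma ord_eq_p: "a \<in> carrier G \<Longrightarrow> a \<noteq> \<one> \<Longrightarrow> ord a = p"
  using ord_eq_prime prime_p pow_p_eq_one by blast

lemma pow_eq_one_transfer:
  fixes k :: nat
  assumes "a \<in> carrier G" "a \<noteq> \<one>" "a [^] k = \<one>" "b \<in> carrier G"
  shows "b [^] k = \<one>"
proof -
  have "p dvd k"
    using pow_eq_id[of a k] ord_eq_p[of a] assms(1-3) by simp
  then show ?thesis
    using ord_eq_p[of b] pow_eq_id[of b k] assms(4) by (cases "b = \<one>") simp_all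
qed

lemma exponent_p_group_subgroup:
  assumes "subgroup H G"
  shows "exponent_p_group (G\<lparr>carrier := H\<rparr>) p"
  using p_group_subgroup[OF assms] subgroup.subset[OF assms] pow_p_eq_one
  by (auto simp: exponent_p_group_def exponent_p_group_axioms_def simp flip: nat_pow_consistent)

end

locale self_centralizing_p_group = exponent_p_group +
  assumes centralizer_subset_self:
    "subgroup H G \<Longrightarrow> \<not> comm_group (G\<lparr>carrier := H\<rparr>) \<Longrightarrow> centralizer G H \<subseteq> H"
begin

lemma self_centralizing_p_group_subgroup:
  assumes "subgroup H G"
  shows "self_centralizing_p_group (G\<lparr>carrier := H\<rparr>) p"
proof (intro self_centralizing_p_group.intro self_centralizing_p_group_axioms.intro)
  show "exponent_p_group (G\<lparr>carrier := H\<rparr>) p"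
    by (rule exponent_p_group_subgroup) fact
  fix K
  assume "subgroup K (G\<lparr>carrier := H\<rparr>)" "\<not> comm_group (G\<lparr>carrier := H, carrier := K\<rparr>)"
  then have "centralizer G K \<subseteq> K"
    using incl_subgroup[OF assms] centralizer_subset_self by simp
  then show "centralizer (G\<lparr>carrier := H\<rparr>) K \<subseteq> K"
    by (simp add: centralizer_carrier_update[OF subgroup.subset[OF assms]] le_infI2)
qed

lemma center_subset_generate_pair:
  assumes "x \<in> carrier G" "y \<in> carrier G" "commutator x y \<noteq> \<one>"
  shows "center G \<subseteq> generate G {x, y}"
proof -
  have "\<not> comm_group (G\<lparr>carrier := generate G {x, y}\<rparr>)"
  proof
    assume "comm_group (G\<lparr>carrier := generate G {x, y}\<rparr>)"
    then interpret H: comm_group "G\<lparr>carrier := generate G {x, y}\<rparr>" .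
    have "x \<otimes> y = y \<otimes> x"
      using H.m_comm[of x y] by (simp add: generate.incl)
    then show False
      using assms by (simp add: commutator_eq_one_iff)
  qed
  then have "centralizer G (generate G {x, y}) \<subseteq> generate G {x, y}"
    using assms(1,2) by (intro centralizer_subset_self generate_is_subgroup) auto
  moreover have "center G \<subseteq> centralizer G (generate G {x, y})"
    using assms(1,2) by (intro centralizer_antimono generate_incl) auto
  ultimately show ?thesis
    by blast
qed

lemma commutator_word_mem_centerD:
  assumes y: "y \<in> second_center" and x: "x \<in> carrier G" and noncomm: "commutator x y \<noteq> \<one>"
    and central: "commutator_word x y i j k \<in> center G"
  shows "x [^] i = \<one>" "y [^] j = \<one>"
proof -
  let ?z = "commutator x y"
  interpret Z: subgroup "center G" G
    by (simp add: subgroup_centralizer)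
  interpret f: group_hom G G "\<lambda>g. commutator g y"
    using commutator_hom_if_second_center[OF y] by unfold_locales
  note yG = second_center_closed[OF y] and zZ = commutator_mem_center[OF y x]
  have commute_y: "commutator g y = \<one>" if "g \<in> center G" for g
    using that yG centralizerD[OF that yG] Z.mem_carrier by (simp add: commutator_eq_one_iff)
  have "commutator y y = \<one>"
    using yG by (simp add: commutator_eq_one_iff)
  then have "?z [^] i = commutator (commutator_word x y i j k) y"
    using x yG zZ commute_y f.hom_nat_pow by (simp add: commutator_word_def)
  also have "\<dots> = \<one>"
    using commute_y[OF central] .
  finally show x_pow: "x [^] i = \<one>"
    using x yG noncomm by (blast intro: pow_eq_one_transfer commutator_closed)
  have "?z [^] k \<in> center G"
    by (induction k) (use zZ in auto)
  moreover have "y [^] j = inv (?z [^] k) \<otimes> commutator_word x y i j k"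
    using x yG x_pow by (simp add: commutator_word_def group_word_simps)
  ultimately have "y [^] j \<in> center G"
    using central by simp
  then have "commutator x (y [^] j) = \<one>"
    using x mem_center_iff Z.mem_carrier by blast
  then have "?z [^] j = \<one>"
    using commutator_pow_right[OF x yG centralizerD[OF zZ yG]] by simp
  then show "y [^] j = \<one>"
    using x yG noncomm by (blast intro: pow_eq_one_transfer commutator_closed)
qed

lemma center_eq_generate_commutator:
  assumes y: "y \<in> second_center" and x: "x \<in> carrier G" and noncomm: "commutator x y \<noteq> \<one>"
  shows "center G = generate G {commutator x y}"
proof
  note yG = second_center_closed[OF y] and zZ = commutator_mem_center[OF y x]
  show "generate G {commutator x y} \<subseteq> center G"
    using zZ by (intro generate_subgroup_incl subgroup_centralizer) auto
  show "center G \<subseteq> generate G {commutator x y}"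
  proof
    fix w assume w: "w \<in> center G"
    then obtain i j k where word: "w = commutator_word x y i j k"
      using center_subset_generate_pair[OF x yG noncomm]
        generate_pair_subset_commutator_words[OF finite_carrier x yG]
        centralizerD[OF zZ x] centralizerD[OF zZ yG]
      by blast
    then have "x [^] i = \<one>" "y [^] j = \<one>"
      using commutator_word_mem_centerD[OF y x noncomm] w by simp_all
    then have "w = commutator x y [^] int k"
      using x yG by (simp add: word commutator_word_def int_pow_int)
    then show "w \<in> generate G {commutator x y}"
      using generate_pow[of "commutator x y"] x yG by auto
  qed
qed

lemma card_center:
  assumes "\<not> comm_group G"
  shows "card (center G) = p"
proof -
  obtain y where y: "y \<in> second_center" "y \<notin> center G"
    using second_center_not_subset_center[OF assms] by blast
  note yG = second_center_closed[OF y(1)]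
  obtain x where x: "x \<in> carrier G" "commutator x y \<noteq> \<one>"
    using y(2) yG mem_center_iff by blast
  then show ?thesis
    using center_eq_generate_commutator[OF y(1) x] ord_eq_p[of "commutator x y"]
      generate_pow_card[of "commutator x y"] yG by simp
qed

lemma centralizer_abelian_if_second_center:
  assumes "\<not> comm_group G" "y \<in> second_center" "y \<notin> center G"
  shows "comm_group (G\<lparr>carrier := centralizer G {y}\<rparr>)"
proof (rule ccontr)
  let ?A = "centralizer G {y}"
  assume nonabelian: "\<not> comm_group (G\<lparr>carrier := ?A\<rparr>)"
  note y = second_center_closed[OF assms(2)]
  have A: "subgroup ?A G"
    using y by (intro subgroup_centralizer) simp
  interpret A: self_centralizing_p_group "G\<lparr>carrier := ?A\<rparr>" p
    by (rule self_centralizing_p_group_subgroup[OF A])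
  have center_A: "center (G\<lparr>carrier := ?A\<rparr>) = ?A \<inter> centralizer G ?A"
    using centralizer_carrier_update[OF centralizer_subset] by simp
  have "insert y (center G) \<subseteq> center (G\<lparr>carrier := ?A\<rparr>)"
    unfolding center_A using y by (auto simp: centralizer_def)
  moreover have "finite (center (G\<lparr>carrier := ?A\<rparr>))"
    using centralizer_subset A.finite_carrier by (rule finite_subset)
  ultimately have "card (insert y (center G)) \<le> p"
    using card_mono A.card_center[OF nonabelian] by metis
  moreover have "card (insert y (center G)) = Suc p"
    using assms(3) card_center[OF assms(1)] finite_subset[OF centralizer_subset finite_carrier] by simp
  ultimately show False
    by simp
qed

lemma card_rcosets_centralizer_if_second_center:
  assumes "\<not> comm_group G" "y \<in> second_center" "y \<notin> center G"
  shows "card (rcosets (centralizer G {y})) = p"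
proof -
  let ?f = "\<lambda>g. commutator g y"
  interpret f: group_hom G G ?f
    using commutator_hom_if_second_center[OF assms(2)] by unfold_locales
  note y = second_center_closed[OF assms(2)]
  have sub: "?f ` carrier G \<subseteq> center G"
    using commutator_mem_center[OF assms(2)] by blast
  have "?f ` carrier G \<noteq> {\<one>}"
    using y assms(3) mem_center_iff by fastforce
  then have "?f ` carrier G = center G"
    using subgroup_prime_card_cases[OF f.img_is_subgroup _ sub] card_center[OF assms(1)] prime_p
    by (auto simp: subgroup_centralizer)
  then show ?thesis
    using f.card_rcosets_kernel kernel_commutator[OF y] card_center[OF assms(1)] by simp
qed

theorem exists_abelian_normal_subgroup_index_p:
  assumes "\<not> comm_group G"
  shows "\<exists>A. A \<lhd> G \<and> comm_group (G\<lparr>carrier := A\<rparr>) \<and> card (rcosets A) = p \<and> center G \<subseteq> A"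
proof -
  obtain y where y: "y \<in> second_center" "y \<notin> center G"
    using second_center_not_subset_center[OF assms] by blast
  note yG = second_center_closed[OF y(1)]
  interpret f: group_hom G G "\<lambda>g. commutator g y"
    using commutator_hom_if_second_center[OF y(1)] by unfold_locales
  have "centralizer G {y} \<lhd> G"
    using f.normal_kernel kernel_commutator[OF yG] by simp
  moreover have "center G \<subseteq> centralizer G {y}"
    using yG by (intro centralizer_antimono) simp
  ultimately show ?thesis
    using centralizer_abelian_if_second_center[OF assms y]
      card_rcosets_centralizer_if_second_center[OF assms y] by blast
qed

end

section \<open>Nilpotent endomorphisms\<close>

lemma (in group) funpow_hom: "T \<in> hom G G \<Longrightarrow> T ^^ n \<in> hom G G"
proof (induction n)
  case 0
  show ?case by (simp add: hom_def)
next
  case (Suc n)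
  then show ?case
    using Group.hom_compose[of "T ^^ n" G G T G] by (simp only: funpow.simps)
qed

lemma (in group) funpow_closed:
  assumes "T \<in> hom G G" "a \<in> carrier G"
  shows "(T ^^ n) a \<in> carrier G"
  using hom_in_carrier[OF funpow_hom[OF assms(1)] assms(2)] .

lemma (in group_hom) card_kernel_Int_mult_card_image:
  assumes "subgroup I G"
  shows "card (kernel G H h \<inter> I) * card (h ` I) = card I"
proof -
  interpret I: group_hom "G\<lparr>carrier := I\<rparr>" H h
    by (rule induced_group_hom') fact
  have "kernel (G\<lparr>carrier := I\<rparr>) H h = kernel G H h \<inter> I"
    using subgroup.subset[OF assms] by (auto simp: kernel_def)
  then show ?thesis
    using I.G.lagrange[OF I.subgroup_kernel] I.card_rcosets_kernel by (simp add: order_def ac_simps)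
qed

locale nilpotent_endomorphism = group_hom G G T for G (structure) and T +
  fixes c :: nat
  assumes funpow_eq_one: "a \<in> carrier G \<Longrightarrow> (T ^^ c) a = \<one>"
begin

lemma subgroup_funpow_image: "subgroup ((T ^^ i) ` carrier G) G"
proof -
  interpret group_hom G G "T ^^ i"
    using G.funpow_hom[OF homh] by unfold_locales
  show ?thesis
    by (rule img_is_subgroup)
qed

lemma funpow_image_antimono: "i \<le> j \<Longrightarrow> (T ^^ j) ` carrier G \<subseteq> (T ^^ i) ` carrier G"
proof (induction rule: dec_induct)
  case (step j)
  have "(T ^^ Suc j) ` carrier G = (T ^^ j) ` T ` carrier G"
    by (simp add: funpow_Suc_right image_comp del: funpow.simps)
  also have "\<dots> \<subseteq> (T ^^ j) ` carrier G"
    by (intro image_mono) auto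
  finally show ?case
    using step.IH by blast
qed simp

lemma kernel_Int_invariant_nontrivial:
  assumes "D \<subseteq> carrier G" "T ` D \<subseteq> D" "d \<in> D" "d \<noteq> \<one>"
  shows "kernel G G T \<inter> D \<noteq> {\<one>}"
proof -
  define j where "j = (LEAST j. (T ^^ j) d = \<one>)"
  have "(T ^^ c) d = \<one>"
    using assms funpow_eq_one by blast
  then have "(T ^^ j) d = \<one>"
    unfolding j_def by (rule LeastI)
  then obtain i where j: "j = Suc i"
    using assms(4) by (cases j) auto
  have "(T ^^ i) d \<noteq> \<one>"
    using not_less_Least[of i "\<lambda>j. (T ^^ j) d = \<one>"] j by (simp add: j_def)
  moreover have "(T ^^ i) d \<in> D"
    by (induction i) (use assms in auto)
  moreover have "T ((T ^^ i) d) = \<one>"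
    using \<open>(T ^^ j) d = \<one>\<close> by (simp add: j)
  ultimately show ?thesis
    using assms(1) by (auto simp: kernel_def)
qed

context
  fixes p m :: nat
  assumes prime: "Factorial_Ring.prime p"
    and card_kernel: "card (kernel G G T) = p"
    and card_carrier: "card (carrier G) = p ^ m"
begin

lemma card_funpow_image_Suc:
  assumes "(T ^^ i) ` carrier G \<noteq> {\<one>}"
  shows "card ((T ^^ i) ` carrier G) = p * card ((T ^^ Suc i) ` carrier G)"
proof -
  let ?D = "(T ^^ i) ` carrier G"
  have D: "subgroup ?D G"
    by (rule subgroup_funpow_image)
  have TD: "T ` ?D = (T ^^ Suc i) ` carrier G"
    by (simp add: image_comp)
  then have "T ` ?D \<subseteq> ?D"
    using funpow_image_antimono[of i "Suc i"] by simp
  moreover obtain d where "d \<in> ?D" "d \<noteq> \<one>"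
    using assms subgroup.one_closed[OF D] by blast
  ultimately have "kernel G G T \<inter> ?D \<noteq> {\<one>}"
    using subgroup.subset[OF D] by (intro kernel_Int_invariant_nontrivial)
  then have "kernel G G T \<inter> ?D = kernel G G T"
    using G.subgroup_prime_card_cases[of "kernel G G T \<inter> ?D" "kernel G G T"] card_kernel prime
      G.subgroups_Inter_pair[OF subgroup_kernel D] subgroup_kernel by blast
  then show ?thesis
    using card_kernel_Int_mult_card_image[OF D] card_kernel TD by simp
qed

lemma card_funpow_image: "i \<le> m \<Longrightarrow> card ((T ^^ i) ` carrier G) = p ^ (m - i)"
proof (induction i)
  case 0
  show ?case by (simp add: card_carrier)
next
  case (Suc i)
  then have card_i: "card ((T ^^ i) ` carrier G) = p * p ^ (m - Suc i)"
    by (simp flip: power_Suc add: Suc_diff_Suc)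
  then have "(T ^^ i) ` carrier G \<noteq> {\<one>}"
    using prime_gt_1_nat[OF prime] by auto
  then show ?case
    using card_funpow_image_Suc[of i] card_i prime_gt_0_nat[OF prime] by simp
qed

lemma funpow_image_trivial_iff: "(T ^^ i) ` carrier G = {\<one>} \<longleftrightarrow> m \<le> i"
proof
  assume trivial: "(T ^^ i) ` carrier G = {\<one>}"
  show "m \<le> i"
  proof (rule ccontr)
    assume "\<not> m \<le> i"
    then have "p ^ (m - i) = 1"
      using card_funpow_image[of i] trivial by simp
    then show False
      using \<open>\<not> m \<le> i\<close> prime_gt_1_nat[OF prime] by simp
  qed
next
  assume "m \<le> i"
  have "(T ^^ m) ` carrier G = {\<one>}"
    using card_funpow_image[of m] subgroup.one_closed[OF subgroup_funpow_image]
    by (metis card_1_singletonE diff_self_eq_0 le_refl power_0 singletonD)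
  then show "(T ^^ i) ` carrier G = {\<one>}"
    using funpow_image_antimono[OF \<open>m \<le> i\<close>] subgroup.one_closed[OF subgroup_funpow_image] by blast
qed

end

end

section \<open>Abelian-by-cyclic groups\<close>

context comm_group
begin

lemma hom_finprod:
  assumes H: "comm_group H" and h: "h \<in> hom G H" and f: "f \<in> I \<rightarrow> carrier G"
  shows "h (\<Otimes>i\<in>I. f i) = (\<Otimes>\<^bsub>H\<^esub>i\<in>I. h (f i))"
proof -
  interpret H: comm_group H by fact
  show ?thesis
    using f
  proof (induction I rule: infinite_finite_induct)
    case (insert i I)
    then show ?case
      using hom_mult[OF h] hom_in_carrier[OF h] by (simp add: Pi_iff)
  qed (simp_all add: hom_one[OF h] is_group H.is_group)
qed

definition binomial_finprod :: "('a \<Rightarrow> 'a) \<Rightarrow> 'a \<Rightarrow> nat \<Rightarrow> 'a" where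
  "binomial_finprod T a m = (\<Otimes>j\<in>{..<m}. (T ^^ j) a [^] (m choose Suc j))"

lemma binomial_finprod_closed:
  "T \<in> hom G G \<Longrightarrow> a \<in> carrier G \<Longrightarrow> binomial_finprod T a m \<in> carrier G"
  by (simp add: binomial_finprod_def Pi_iff funpow_closed)

lemma binomial_finprod_Suc:
  assumes T: "T \<in> hom G G" and a: "a \<in> carrier G"
  shows "binomial_finprod T a (Suc m) = a \<otimes> (T (binomial_finprod T a m) \<otimes> binomial_finprod T a m)"
proof -
  let ?t = "\<lambda>j. (T ^^ j) a"
  have t: "?t j \<in> carrier G" for j
    by (rule funpow_closed) fact+
  have T_prod: "T (binomial_finprod T a m) = (\<Otimes>j\<in>{..<m}. ?t (Suc j) [^] (m choose Suc j))"
    using t hom_nat_pow[OF T] is_group by (simp add: binomial_finprod_def hom_finprod[OF comm_group_axioms T] Pi_iff)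
  have shift: "(\<Otimes>j\<in>{..<m}. ?t (Suc j) [^] (m choose Suc j)) \<otimes> a = (\<Otimes>j\<in>{..m}. ?t j [^] (m choose j))"
    using t a
    by (cases m) (simp_all add: finprod_Suc2 lessThan_Suc_atMost
        del: finprod_Suc funpow.simps(2) binomial_Suc_Suc)
  have extend: "binomial_finprod T a m = (\<Otimes>j\<in>{..m}. ?t j [^] (m choose Suc j))"
    using t by (subst finprod_Suc3) (auto simp: binomial_finprod_def binomial_eq_0)
  have "binomial_finprod T a (Suc m) =
      (\<Otimes>j\<in>{..m}. ?t j [^] (m choose j)) \<otimes> (\<Otimes>j\<in>{..m}. ?t j [^] (m choose Suc j))"
    using t by (simp add: binomial_finprod_def lessThan_Suc_atMost nat_pow_mult flip: finprod_multf)
  also have "\<dots> = T (binomial_finprod T a m) \<otimes> a \<otimes> binomial_finprod T a m"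
    unfolding extend[symmetric] shift[symmetric] T_prod[symmetric] ..
  also have "\<dots> = a \<otimes> (T (binomial_finprod T a m) \<otimes> binomial_finprod T a m)"
    using a binomial_finprod_closed[OF T a] hom_in_carrier[OF T] by (simp add: m_ac)
  finally show ?thesis .
qed

lemma binomial_finprod_prime:
  assumes T: "T \<in> hom G G" and a: "a \<in> carrier G"
    and p: "Factorial_Ring.prime p" and exponent: "\<And>b. b \<in> carrier G \<Longrightarrow> b [^] p = \<one>"
  shows "binomial_finprod T a p = (T ^^ (p - 1)) a"
proof -
  let ?t = "\<lambda>j. (T ^^ j) a"
  have t: "?t j \<in> carrier G" for j
    by (rule funpow_closed) fact+
  obtain q where q: "p = Suc q"
    using prime_gt_0_nat[OF p] gr0_conv_Suc by blast
  have "?t j [^] (p choose Suc j) = \<one>" if "j < q" for j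
  proof -
    have "p dvd (p choose Suc j)"
      using p that q by (intro dvd_choose_prime) auto
    then show ?thesis
      using t exponent[OF t] by (auto simp flip: nat_pow_pow elim: dvdE)
  qed
  then have "(\<Otimes>j\<in>{..<q}. ?t j [^] (p choose Suc j)) = \<one>"
    by (intro finprod_one_eqI) simp
  then show ?thesis
    using t by (simp add: binomial_finprod_def q lessThan_Suc del: binomial_Suc_Suc)
qed

end

locale abelian_by_cyclic = group G for G (structure) +
  fixes A x
  assumes A_normal: "A \<lhd> G"
    and A_abelian: "comm_group (G\<lparr>carrier := A\<rparr>)"
    and x_closed [simp]: "x \<in> carrier G"
    and generated: "generate G (insert x A) = carrier G"
begin

abbreviation GA where "GA \<equiv> G\<lparr>carrier := A\<rparr>"

sublocale A: normal A G
  by (rule A_normal)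

sublocale GA: comm_group GA
  by (rule A_abelian)

lemma subgroup_eq_carrierI:
  assumes "subgroup S G" "A \<subseteq> S" "x \<in> S"
  shows "S = carrier G"
  using generate_subgroup_incl[of "insert x A" S] subgroup.subset[of S G] generated assms by auto

lemma A_comm: "a \<in> A \<Longrightarrow> b \<in> A \<Longrightarrow> a \<otimes> b = b \<otimes> a"
  using GA.m_comm by simp

lemma conj_A: "a \<in> A \<Longrightarrow> b \<in> A \<Longrightarrow> a \<otimes> b \<otimes> inv a = b"
  by (rule conj_eq_self_iff[THEN iffD2, OF _ _ A_comm]) simp_all

lemma commutator_mem_A: "g \<in> carrier G \<Longrightarrow> a \<in> A \<Longrightarrow> commutator g a \<in> A"
  unfolding commutator_def using A.inv_op_closed2 by blast

lemma commutator_A_eq_one: "a \<in> A \<Longrightarrow> b \<in> A \<Longrightarrow> commutator a b = \<one>"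
  by (simp add: commutator_eq_one_iff A_comm)

lemma commutator_hom: "g \<in> carrier G \<Longrightarrow> commutator g \<in> hom GA GA"
  by (intro homI) (simp_all add: commutator_mem_A commutator_mult_right conj_A)

lemma kernel_commutator_x: "kernel GA GA (commutator x) = A \<inter> center G"
proof -
  have "a \<in> center G" if a: "a \<in> A" "commutator x a = \<one>" for a
  proof -
    have whole: "centralizer G {a} = carrier G"
      using a by (intro subgroup_eq_carrierI subgroup_centralizer)
        (auto simp: centralizer_def A_comm commutator_eq_one_iff)
    show ?thesis
    proof (rule centralizerI)
      show "a \<otimes> g = g \<otimes> a" if "g \<in> carrier G" for g
        using that whole centralizerD[of g G "{a}" a] by simp
    qed (use a in simp)
  qed
  moreover have "commutator x a = \<one>" if "a \<in> center G" for a
    using that centralizerD[OF that x_closed] subsetD[OF centralizer_subset that]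
    by (simp add: commutator_eq_one_iff)
  ultimately show ?thesis
    by (auto simp: kernel_def)
qed

lemma conj_commutator_x:
  assumes "g \<in> carrier G" "a \<in> A"
  shows "g \<otimes> commutator x a \<otimes> inv g = commutator x (g \<otimes> a \<otimes> inv g)"
proof -
  let ?S = "{g \<in> carrier G. \<forall>a \<in> A. g \<otimes> commutator x a \<otimes> inv g = commutator x (g \<otimes> a \<otimes> inv g)}"
  have "subgroup ?S G"
    by (rule subgroup_conj_equivariant) (simp_all add: A_normal)
  moreover have "A \<subseteq> ?S"
    by (auto simp: conj_A commutator_mem_A)
  moreover have "x \<in> ?S"
    using conj_commutator[OF x_closed x_closed] conj_eq_self_iff[OF x_closed x_closed] by simp
  ultimately show ?thesis
    using subgroup_eq_carrierI assms by blast
qed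

lemma commutator_x_image_normal:
  assumes "B \<lhd> G" "B \<subseteq> A"
  shows "commutator x ` B \<lhd> G"
proof (rule normal_invI)
  interpret T: group_hom GA GA "commutator x"
    using commutator_hom[OF x_closed] by unfold_locales
  have "subgroup B GA"
    by (rule subgroup_incl[OF normal_imp_subgroup[OF assms(1)] A.subgroup_axioms assms(2)])
  then show "subgroup (commutator x ` B) G"
    using T.subgroup_img_is_subgroup incl_subgroup[OF A.subgroup_axioms] by blast
next
  fix g n assume g: "g \<in> carrier G" and "n \<in> commutator x ` B"
  then obtain b where b: "b \<in> B" "n = commutator x b"
    by blast
  then have "g \<otimes> n \<otimes> inv g = commutator x (g \<otimes> b \<otimes> inv g)"
    using conj_commutator_x[OF g] assms(2) by blast
  then show "g \<otimes> n \<otimes> inv g \<in> commutator x ` B"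
    using normal.inv_op_closed2[OF assms(1) g b(1)] by simp
qed

lemma commutator_mem_commutator_x_image:
  assumes "B \<lhd> G" "B \<subseteq> A" "b \<in> B" "g \<in> carrier G"
  shows "commutator b g \<in> commutator x ` B"
proof -
  interpret N: normal "commutator x ` B" G
    by (rule commutator_x_image_normal) fact+
  have b: "b \<in> A" "b \<in> carrier G"
    using assms by auto
  let ?S = "{g \<in> carrier G. commutator b g \<in> commutator x ` B}"
  have "subgroup ?S G"
    by (rule subgroup_commutator_mem[OF N.normal_axioms b(2)])
  moreover have "A \<subseteq> ?S"
    using b N.one_closed by (auto simp: commutator_A_eq_one)
  moreover have "x \<in> ?S"
    using assms(3) b N.m_inv_closed[of "commutator x b"] by (simp add: inv_commutator)
  ultimately show ?thesis
    using subgroup_eq_carrierI assms(4) by blast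
qed

lemma commutator_mem_commutator_x_image_A:
  assumes "g \<in> carrier G" "h \<in> carrier G"
  shows "commutator g h \<in> commutator x ` A"
proof -
  interpret N: normal "commutator x ` A" G
    using A_normal by (rule commutator_x_image_normal) simp
  let ?S = "\<lambda>g. {h \<in> carrier G. commutator g h \<in> commutator x ` A}"
  have S: "subgroup (?S g) G" if "g \<in> carrier G" for g
    by (rule subgroup_commutator_mem[OF N.normal_axioms that])
  have A_S: "A \<subseteq> ?S g" if "g \<in> carrier G" for g
  proof
    fix a assume a: "a \<in> A"
    then have "inv (commutator a g) \<in> commutator x ` A"
      using commutator_mem_commutator_x_image[OF A_normal _ a that] by (intro N.m_inv_closed) simp
    then show "a \<in> ?S g"
      using a that by (simp add: inv_commutator)
  qed
  have "commutator x x = \<one>"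
    by (simp add: commutator_eq_one_iff)
  then have "commutator x x \<in> commutator x ` A"
    using N.one_closed by simp
  then have "?S x = carrier G"
    by (intro subgroup_eq_carrierI S A_S) simp_all
  then have "inv (commutator x g) \<in> commutator x ` A"
    using assms(1) by (intro N.m_inv_closed) blast
  then have "x \<in> ?S g"
    using assms(1) by (simp add: inv_commutator)
  then have "?S g = carrier G"
    using assms(1) by (intro subgroup_eq_carrierI S A_S)
  then show ?thesis
    using assms(2) by blast
qed

lemma commutator_subgroup_normal_in_A:
  assumes "B \<lhd> G" "B \<subseteq> A"
  shows "commutator_subgroup G B (carrier G) = commutator x ` B"
  unfolding commutator_subgroup_eq_generate
proof
  show "generate G {commutator b g | b g. b \<in> B \<and> g \<in> carrier G} \<subseteq> commutator x ` B"
    using assms commutator_mem_commutator_x_image normal_imp_subgroup[OF commutator_x_image_normal]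
    by (intro generate_subgroup_incl) auto
  show "commutator x ` B \<subseteq> generate G {commutator b g | b g. b \<in> B \<and> g \<in> carrier G}"
  proof
    fix c assume "c \<in> commutator x ` B"
    then obtain b where b: "b \<in> B" "c = commutator x b"
      by blast
    then have "c = inv (commutator b x)"
      using assms(2) by (simp add: inv_commutator subsetD)
    then show "c \<in> generate G {commutator b g | b g. b \<in> B \<and> g \<in> carrier G}"
      using b(1) x_closed by (auto simp only: intro!: generate.inv)
  qed
qed

lemma commutator_subgroup_carrier:
  "commutator_subgroup G (carrier G) (carrier G) = commutator x ` A"
  unfolding commutator_subgroup_eq_generate
proof
  show "generate G {commutator g h | g h. g \<in> carrier G \<and> h \<in> carrier G} \<subseteq> commutator x ` A"
    using commutator_mem_commutator_x_image_A
      normal_imp_subgroup[OF commutator_x_image_normal[OF A_normal]]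
    by (intro generate_subgroup_incl) auto
  show "commutator x ` A \<subseteq> generate G {commutator g h | g h. g \<in> carrier G \<and> h \<in> carrier G}"
    using x_closed A.subset by (blast intro: generate.incl)
qed

lemma funpow_commutator_image_normal: "(commutator x ^^ i) ` A \<lhd> G"
  and funpow_commutator_image_subset: "(commutator x ^^ i) ` A \<subseteq> A"
proof -
  have "(commutator x ^^ i) ` A \<lhd> G \<and> (commutator x ^^ i) ` A \<subseteq> A"
  proof (induction i)
    case (Suc i)
    have "(commutator x ^^ Suc i) ` A = commutator x ` (commutator x ^^ i) ` A"
      by (simp add: image_comp)
    then show ?case
      using Suc commutator_x_image_normal commutator_mem_A by auto
  qed (simp add: A_normal)
  then show "(commutator x ^^ i) ` A \<lhd> G" "(commutator x ^^ i) ` A \<subseteq> A"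
    by blast+
qed

lemma lower_central_Suc_eq: "lower_central G (Suc i) = (commutator x ^^ Suc i) ` A"
proof (induction i)
  case 0
  show ?case
    by (simp add: commutator_subgroup_carrier)
next
  case (Suc i)
  have "lower_central G (Suc (Suc i)) = commutator x ` (commutator x ^^ Suc i) ` A"
    unfolding lower_central.simps(2)[of G "Suc i"] Suc
    by (intro commutator_subgroup_normal_in_A funpow_commutator_image_normal
        funpow_commutator_image_subset)
  then show ?case
    by (simp add: image_comp)
qed

lemma pow_mult_eq_binomial_finprod:
  assumes a: "a \<in> A"
  shows "(a \<otimes> x) [^] (m::nat) = GA.binomial_finprod (commutator x) a m \<otimes> x [^] m"
proof (induction m)
  case 0
  show ?case by (simp add: GA.binomial_finprod_def)
next
  case (Suc m)
  let ?P = "GA.binomial_finprod (commutator x) a"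
  have P: "?P m \<in> A" for m
    using GA.binomial_finprod_closed[OF commutator_hom[OF x_closed]] a by simp
  have aG: "a \<in> carrier G" and PG: "?P m \<in> carrier G"
    using a P by auto
  have "(a \<otimes> x) [^] Suc m = (a \<otimes> x) \<otimes> (a \<otimes> x) [^] m"
    by (rule nat_pow_Suc2) (use aG in simp)
  also have "\<dots> = a \<otimes> (x \<otimes> ?P m) \<otimes> x [^] m"
    using Suc aG PG by (simp add: m_assoc)
  also have "x \<otimes> ?P m = commutator x (?P m) \<otimes> (?P m \<otimes> x)"
    using mult_eq_commutator_mult[OF x_closed PG] .
  also have "a \<otimes> (commutator x (?P m) \<otimes> (?P m \<otimes> x)) \<otimes> x [^] m
      = (a \<otimes> (commutator x (?P m) \<otimes> ?P m)) \<otimes> (x \<otimes> x [^] m)"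
    using aG PG by (simp add: m_assoc)
  also have "a \<otimes> (commutator x (?P m) \<otimes> ?P m) = ?P (Suc m)"
    using GA.binomial_finprod_Suc[OF commutator_hom[OF x_closed]] a by simp
  finally show ?case
    using nat_pow_Suc2[OF x_closed] by simp
qed

lemma funpow_commutator_eq_one:
  assumes p: "Factorial_Ring.prime p" and exponent: "\<And>g. g \<in> carrier G \<Longrightarrow> g [^] p = \<one>"
    and a: "a \<in> A"
  shows "(commutator x ^^ (p - 1)) a = \<one>"
proof -
  have "GA.binomial_finprod (commutator x) a p = (commutator x ^^ (p - 1)) a"
    using a by (intro GA.binomial_finprod_prime commutator_hom p)
      (simp_all add: exponent flip: nat_pow_consistent)
  moreover have "GA.binomial_finprod (commutator x) a p \<in> carrier G"
    using GA.binomial_finprod_closed[OF commutator_hom[OF x_closed]] a by auto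
  ultimately show ?thesis
    using pow_mult_eq_binomial_finprod[OF a, of p] exponent a by simp
qed

end

section \<open>Maximal class\<close>

locale abelian_by_cyclic_prime_center = abelian_by_cyclic +
  fixes p m :: nat
  assumes prime: "Factorial_Ring.prime p"
    and pow_p_eq_one: "g \<in> carrier G \<Longrightarrow> g [^] p = \<one>"
    and card_A: "card A = p ^ m"
    and card_A_Int_center: "card (A \<inter> center G) = p"
begin

sublocale commutation: nilpotent_endomorphism GA "commutator x" "p - 1"
  using commutator_hom[OF x_closed] funpow_commutator_eq_one[OF prime pow_p_eq_one]
  by unfold_locales simp_all

lemma funpow_commutator_image_trivial_iff: "(commutator x ^^ i) ` A = {\<one>} \<longleftrightarrow> m \<le> i"
  using commutation.funpow_image_trivial_iff[OF prime, of m i] card_A card_A_Int_center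
  by (simp add: kernel_commutator_x)

lemma m_less_p: "m < p"
proof -
  have "(commutator x ^^ (p - 1)) ` A = (\<lambda>_. \<one>) ` A"
    by (intro image_cong refl funpow_commutator_eq_one[OF prime pow_p_eq_one])
  also have "\<dots> = {\<one>}"
    using A.one_closed by (intro image_constant)
  finally have "m \<le> p - 1"
    by (simp only: funpow_commutator_image_trivial_iff)
  then show ?thesis
    using prime_gt_0_nat[OF prime] by simp
qed

lemma m_gt_0: "0 < m"
proof (rule ccontr)
  assume "\<not> 0 < m"
  then have "card A = 1"
    using card_A by simp
  then have "card (A \<inter> center G) \<le> 1"
    by (metis card_mono card_ge_0_finite inf_le1 zero_less_one)
  then show False
    using card_A_Int_center prime_gt_1_nat[OF prime] by simp
qed

lemma lower_central_trivial_iff: "lower_central G c = {\<one>} \<longleftrightarrow> m \<le> c"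
proof (cases c)
  case 0
  have "A \<noteq> {\<one>}"
    using funpow_commutator_image_trivial_iff[of 0] m_gt_0 by simp
  then have "carrier G \<noteq> {\<one>}"
    using A.subset A.one_closed by blast
  then show ?thesis
    using 0 m_gt_0 by simp
next
  case (Suc i)
  then show ?thesis
    by (simp only: lower_central_Suc_eq funpow_commutator_image_trivial_iff)
qed

lemma is_nilpotent_group: "nilpotent_group G"
  using is_group by (auto simp: nilpotent_group_def lower_central_trivial_iff)

lemma nilpotency_class_eq: "nilpotency_class G = m"
  unfolding nilpotency_class_def lower_central_trivial_iff by (rule Least_equality) simp_all

end

lemma (in group) generate_insert_prime_index:
  assumes "finite (carrier G)" "subgroup A G" "Factorial_Ring.prime (card (rcosets A))"
    and "x \<in> carrier G" "x \<notin> A"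
  shows "generate G (insert x A) = carrier G"
proof (rule prime_index_maximal[OF assms(1-3)])
  show "subgroup (generate G (insert x A)) G"
    using assms(4) subgroup.subset[OF assms(2)] by (intro generate_is_subgroup) simp
  show "A \<subset> generate G (insert x A)"
    using assms(5) by (auto intro: generate.incl)
qed

context exponent_p_group
begin

lemma elementary_abelian_iff_comm_group: "elementary_abelian p G \<longleftrightarrow> comm_group G"
  by (simp add: elementary_abelian_def pow_p_eq_one)

lemma maximal_class_if_abelian_index_p:
  assumes A: "A \<lhd> G" "comm_group (G\<lparr>carrier := A\<rparr>)" "card (rcosets A) = p"
    and center: "center G \<subseteq> A" "card (center G) = p"
  shows "maximal_class p G" "order G \<le> p ^ p"
proof -
  have subA: "subgroup A G"
    using A(1) by (rule normal_imp_subgroup)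
  have order: "order G = p * card A"
    using lagrange[OF subA] A(3) by simp
  then obtain m where m: "card A = p ^ m"
    using dvd_order_prime_power by (metis dvd_triv_right)
  have "A \<noteq> carrier G"
    using order m prime_gt_1_nat[OF prime_p] by (auto simp: order_def)
  then obtain x where x: "x \<in> carrier G" "x \<notin> A"
    using subgroup.subset[OF subA] by blast
  then have "generate G (insert x A) = carrier G"
    using generate_insert_prime_index[OF finite_carrier subA] A(3) prime_p by simp
  then interpret abelian_by_cyclic_prime_center G A x p m
    using A(1,2) x(1) center m prime_p pow_p_eq_one
    by (intro abelian_by_cyclic_prime_center.intro abelian_by_cyclic.intro group_axioms
        abelian_by_cyclic_axioms.intro abelian_by_cyclic_prime_center_axioms.intro)
      (simp_all add: Int_absorb1)
  have order_Suc: "order G = p ^ Suc m"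
    using order m by simp
  then show "maximal_class p G"
    unfolding maximal_class_def using m_gt_0 is_nilpotent_group nilpotency_class_eq
    by (intro exI[of _ "Suc m"]) simp
  show "order G \<le> p ^ p"
    unfolding order_Suc using m_less_p prime_gt_0_nat[OF prime_p] by (intro power_increasing) simp_all
qed

end

theorem theorem6p14:
  fixes G (structure) and p :: nat
  assumes "Factorial_Ring.prime p"
    and "group G" and "finite (carrier G)"
    and "\<exists>n. order G = p ^ n"
    and "has_exponent G p"
    and "\<And>H. subgroup H G \<Longrightarrow> \<not> comm_group (G\<lparr>carrier := H\<rparr>) \<Longrightarrow> centralizer G H \<subseteq> H"
  shows "(order G > p ^ p \<longrightarrow> elementary_abelian p G)
       \<and> (order G \<le> p ^ p \<longrightarrow>
            (elementary_abelian p G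
             \<or> (maximal_class p G
                \<and> (\<exists>A. subgroup A G \<and> card (rcosets A) = p
                       \<and> elementary_abelian p (G\<lparr>carrier := A\<rparr>)))))"
proof -
  interpret group G by fact
  interpret self_centralizing_p_group G p
    using assms(1,4-6) by unfold_locales (auto simp: has_exponent_def)
  show ?thesis
  proof (cases "comm_group G")
    case True
    then show ?thesis
      by (simp add: elementary_abelian_iff_comm_group)
  next
    case False
    then obtain A where A: "A \<lhd> G" "comm_group (G\<lparr>carrier := A\<rparr>)" "card (rcosets A) = p" "center G \<subseteq> A"
      using exists_abelian_normal_subgroup_index_p by blast
    have "maximal_class p G" "order G \<le> p ^ p"
      using maximal_class_if_abelian_index_p[OF A card_center[OF False]] by blast+
    moreover have "elementary_abelian p (G\<lparr>carrier := A\<rparr>)"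
      using A(2) exponent_p_group.elementary_abelian_iff_comm_group[OF
          exponent_p_group_subgroup[OF normal_imp_subgroup[OF A(1)]]] by simp
    ultimately show ?thesis
      using A(1,3) normal_imp_subgroup by auto
  qed
qed

end
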